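(* Let $0<q<p<1$ and let $f$ be a function with domain $[0,\infty)$. If $|f(x)x^{\alpha}|$ is bounded on the interval $(0,A]$ for some $0\le\alpha<1$, then the $pq$-integral $$\int f(x)\,d_{pq}x=\sum_{j=0}^{\infty}\left(x^{q^{j}p^{-j}}-x^{q^{j+1}p^{-j-1}}\right)f\left(x^{q^{j}p^{-j-1}}\right)$$ converges to a function $H(x)$ on $(0,A]$, which is a $pq$-antiderivative of $f(x)$. In addition, $H(x)$ is continuous at $x=1$ with $H(1)=0$.
   Context: The $pq$-derivative of a function $F$ is $D_{pq}F(x)=\dfrac{F(x^{p})-F(x^{q})}{x^{p}-x^{q}}$ for $x\neq 0,1$, with $D_{pq}F(0)=\lim_{x\to0^{+}}D_{pq}F(x)$ and $D_{pq}F(1)=\lim_{x\to1}D_{pq}F(x)$. A function $F$ is a $pq$-antiderivative of $f$ if $D_{pq}F(x)=f(x)$. Exponents are real powers: $x^{q^{j}p^{-j-1}}$ is $x$ raised to the power $q^{j}p^{-j-1}$.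
   Formalization: The formal theorem assumes A ≥ 1 (for A < 1 the series can diverge), and claims D_pq H(1) = f(1) only when f is continuous at 1 (the indicator of {1} is a counterexample otherwise); the antiderivative property is stated on (0,A], so not at x = 0. *)

theory Defs
  imports "HOL-Analysis.Analysis"
begin

definition pq_quotient :: "real \<Rightarrow> real \<Rightarrow> (real \<Rightarrow> real) \<Rightarrow> real \<Rightarrow> real" where
  "pq_quotient p q F x = (F (x powr p) - F (x powr q)) / (x powr p - x powr q)"

(* D is the pq-derivative at x of a function F whose domain is S; at 0 and 1 this includes the
   existence of the defining limit, which is taken inside S. *)
definition has_pq_derivative ::
    "real \<Rightarrow> real \<Rightarrow> (real \<Rightarrow> real) \<Rightarrow> real \<Rightarrow> real \<Rightarrow> real set \<Rightarrow> bool" where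
  "has_pq_derivative p q F D x S \<longleftrightarrow>
     (if x = 0 then (pq_quotient p q F \<longlongrightarrow> D) (at 0 within S \<inter> {0<..})
      else if x = 1 then (pq_quotient p q F \<longlongrightarrow> D) (at 1 within S)
      else pq_quotient p q F x = D)"

definition pq_antiderivative_on ::
    "real \<Rightarrow> real \<Rightarrow> real set \<Rightarrow> (real \<Rightarrow> real) \<Rightarrow> (real \<Rightarrow> real) \<Rightarrow> bool" where
  "pq_antiderivative_on p q S F f \<longleftrightarrow> (\<forall>x\<in>S. has_pq_derivative p q F (f x) x S)"

definition pq_term :: "real \<Rightarrow> real \<Rightarrow> (real \<Rightarrow> real) \<Rightarrow> real \<Rightarrow> nat \<Rightarrow> real" where
  "pq_term p q f x j =
     (x powr (q ^ j / p ^ j) - x powr (q ^ (j + 1) / p ^ (j + 1))) * f (x powr (q ^ j / p ^ (j + 1)))"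

definition pq_integral :: "real \<Rightarrow> real \<Rightarrow> (real \<Rightarrow> real) \<Rightarrow> real \<Rightarrow> real" where
  "pq_integral p q f x = (\<Sum>j. pq_term p q f x j)"

end

(* With r = q / p, the differences x^(r^j) - x^(r^(j+1)) have constant sign and telescope, so their
   absolute values sum to |x - 1|. The sample points x^(r^j / p) tend to 1, hence eventually lie in
   a compact subset of (0, A], on which f is bounded. This gives absolute convergence and, with a
   bound uniform in x near 1, the estimate |H(x)| <= B |x - 1|, i.e. continuity at 1. Replacing x by
   x^q instead of x^p shifts the series by one place, so H(x^p) - H(x^q) is its first term at x^p,
   which is (x^p - x^q) f(x). *)
theory Submission
  imports Defs
begin

lemma powr_tendsto_one:
  fixes x :: real
  assumes "0 < x" and "e \<longlonglongrightarrow> (0::real)"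
  shows "(\<lambda>j. x powr e j) \<longlonglongrightarrow> 1"
  using tendsto_powr[OF tendsto_const assms(2), of x] assms(1) by simp

text \<open>The exponents decrease to 0, so every difference has the sign of \<open>x - 1\<close>,
  and taking absolute values changes the telescoping sum by at most one global sign.\<close>

lemma sums_abs_powr_diff:
  fixes x r :: real
  assumes x: "0 < x" and r: "0 \<le> r" "r < 1"
  shows "(\<lambda>j. \<bar>x powr (r ^ j) - x powr (r ^ (j + 1))\<bar>) sums \<bar>x - 1\<bar>"
proof -
  have "(\<lambda>j. x powr (r ^ j)) \<longlonglongrightarrow> 1"
    using x r by (intro powr_tendsto_one LIMSEQ_power_zero) auto
  from telescope_sums'[OF this]
  have S: "(\<lambda>j. x powr (r ^ j) - x powr (r ^ (j + 1))) sums (x - 1)"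
    using x by simp
  have le: "r ^ (j + 1) \<le> r ^ j" for j
    using r by (intro power_decreasing) auto
  show ?thesis
  proof (cases "1 \<le> x")
    case True
    then have "x powr (r ^ (j + 1)) \<le> x powr (r ^ j)" for j
      by (intro powr_mono le)
    with S True show ?thesis by simp
  next
    case False
    then have "x powr (r ^ j) \<le> x powr (r ^ (j + 1))" for j
      using x by (intro powr_mono' le) auto
    with sums_minus[OF S] False show ?thesis by simp
  qed
qed

lemma pq_term_ratio:
  "pq_term p q f x j =
    (x powr ((q / p) ^ j) - x powr ((q / p) ^ (j + 1))) * f (x powr ((q / p) ^ j / p))"
  by (simp add: pq_term_def power_divide mult.commute)

lemma abs_pq_term_le:
  assumes "\<bar>f (x powr ((q / p) ^ j / p))\<bar> \<le> B"
  shows "\<bar>pq_term p q f x j\<bar> \<le>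
    B * \<bar>x powr ((q / p) ^ j) - x powr ((q / p) ^ (j + 1))\<bar>"
  unfolding pq_term_ratio abs_mult
  by (subst mult.commute) (rule mult_right_mono[OF assms abs_ge_zero])

text \<open>The bound is asked only from \<open>N\<close> on: when \<open>x > 1\<close>, the first
  sample points have exponents above 1 and may leave (0, A].\<close>

lemma summable_pq_term:
  fixes p q x :: real
  assumes "0 < q" "q < p" "0 < x"
    and bound: "\<And>j. j \<ge> N \<Longrightarrow> \<bar>f (x powr ((q / p) ^ j / p))\<bar> \<le> B"
  shows "summable (pq_term p q f x)"
proof (rule summable_comparison_test')
  show "summable (\<lambda>j. B * \<bar>x powr ((q / p) ^ j) - x powr ((q / p) ^ (j + 1))\<bar>)"
    using assms by (intro summable_mult sums_summable[OF sums_abs_powr_diff]) auto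
  show "norm (pq_term p q f x j) \<le> B * \<bar>x powr ((q / p) ^ j) - x powr ((q / p) ^ (j + 1))\<bar>"
    if "j \<ge> N" for j
    unfolding real_norm_def by (intro abs_pq_term_le bound that)
qed

lemma abs_pq_integral_le:
  fixes p q x :: real
  assumes "0 < q" "q < p" "0 < x"
    and bound: "\<And>j. \<bar>f (x powr ((q / p) ^ j / p))\<bar> \<le> B"
  shows "\<bar>pq_integral p q f x\<bar> \<le> B * \<bar>x - 1\<bar>"
proof -
  have "(\<lambda>j. B * \<bar>x powr ((q / p) ^ j) - x powr ((q / p) ^ (j + 1))\<bar>) sums (B * \<bar>x - 1\<bar>)"
    using assms by (intro sums_mult sums_abs_powr_diff) auto
  moreover have "\<bar>pq_term p q f x j\<bar> \<le>
      B * \<bar>x powr ((q / p) ^ j) - x powr ((q / p) ^ (j + 1))\<bar>" for j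
    by (intro abs_pq_term_le bound)
  ultimately show ?thesis
    unfolding pq_integral_def sums_iff
    using norm_suminf_le[of "pq_term p q f x"] by (metis (no_types, lifting) real_norm_def)
qed

lemma pq_integral_one: "pq_integral p q f 1 = 0"
  by (simp add: pq_integral_def pq_term_def)

lemma pq_quotient_pq_integral:
  fixes p q x :: real
  assumes pq: "0 < q" "q < p" and x: "0 < x" "x \<noteq> 1"
    and summ: "summable (pq_term p q f (x powr p))"
  shows "pq_quotient p q (pq_integral p q f) x = f x"
proof -
  \<comment> \<open>Both sides have the same powers of \<open>x\<close>, for instance q * (q/p)^j =
    p * (q/p)^(j+1) in the leading one.\<close>
  have shift: "pq_term p q f (x powr q) j = pq_term p q f (x powr p) (Suc j)" for j
    using pq by (simp add: pq_term_def powr_powr divide_simps mult_ac)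
  have first: "pq_term p q f (x powr p) 0 = (x powr p - x powr q) * f x"
    using pq x by (simp add: pq_term_def powr_powr)
  have "pq_integral p q f (x powr p) - pq_integral p q f (x powr q) = (x powr p - x powr q) * f x"
    using suminf_split_head[OF summ] by (simp add: pq_integral_def shift first)
  moreover have "x powr p \<noteq> x powr q"
    using pq x by (simp add: powr_inj)
  ultimately show ?thesis
    by (simp add: pq_quotient_def)
qed

text \<open>On [L, A] the weight is at least \<open>L powr \<alpha>\<close>, so it can be divided
  out at the cost of a constant.\<close>

lemma weighted_bound_imp_bound:
  fixes f :: "real \<Rightarrow> real"
  assumes M: "\<And>y. y \<in> {0<..A} \<Longrightarrow> \<bar>f y * y powr \<alpha>\<bar> \<le> M"
    and "0 \<le> \<alpha>" "0 < L" "L \<le> y" "y \<le> A"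
  shows "\<bar>f y\<bar> \<le> M / L powr \<alpha>"
proof -
  have "\<bar>f y\<bar> * L powr \<alpha> \<le> \<bar>f y\<bar> * y powr \<alpha>"
    using assms by (intro mult_left_mono powr_mono2) auto
  also have "\<dots> \<le> M"
    using M[of y] assms by (simp add: abs_mult)
  finally show ?thesis
    using assms by (simp add: field_simps)
qed

text \<open>This keeps the sample points away from 0: a base cutoff \<open>c\<close> and the largest
  exponent 1/p give the common lower bound \<open>c powr (1 / p)\<close>.\<close>

lemma powr_mono_base_antimono_exponent:
  fixes c x s t :: real
  assumes "0 < c" "c \<le> 1" "c \<le> x" "0 \<le> s" "s \<le> t"
  shows "c powr t \<le> x powr s"
proof -
  have "c powr t \<le> c powr s" using assms by (intro powr_mono') auto
  also have "\<dots> \<le> x powr s" using assms by (intro powr_mono2) auto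
  finally show ?thesis .
qed

text \<open>Since 1 \<le> A, this reduces staying below \<open>A\<close> to a check at the largest
  exponent.\<close>

lemma powr_le_max_one:
  fixes x s t :: real
  assumes "0 < x" "0 \<le> s" "s \<le> t"
  shows "x powr s \<le> max 1 (x powr t)"
proof (cases "1 \<le> x")
  case True
  with assms have "x powr s \<le> x powr t" by (intro powr_mono)
  then show ?thesis by simp
next
  case False
  with assms have "x powr s \<le> 1" by (intro powr_le1) auto
  then show ?thesis by simp
qed

theorem theorem3p1:
  fixes p q \<alpha> A :: real and f :: "real \<Rightarrow> real"
  assumes "0 < q" and "q < p" and "p < 1"
    and "0 \<le> \<alpha>" and "\<alpha> < 1"
    and "1 \<le> A"
    and "\<exists>M. \<forall>x\<in>{0<..A}. \<bar>f x * x powr \<alpha>\<bar> \<le> M"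
  shows "(\<forall>x\<in>{0<..A}. summable (pq_term p q f x))
    \<and> pq_antiderivative_on p q ({0<..A} - {1}) (pq_integral p q f) f
    \<and> (continuous (at 1 within {0<..A}) f
         \<longrightarrow> pq_antiderivative_on p q {0<..A} (pq_integral p q f) f)
    \<and> continuous (at 1 within {0<..A}) (pq_integral p q f)
    \<and> pq_integral p q f 1 = 0"
proof -
  have pq: "0 < q" "q < p" "p < 1" "0 < p" and A: "1 \<le> A"
    using assms by auto
  obtain M where M: "\<And>y. y \<in> {0<..A} \<Longrightarrow> \<bar>f y * y powr \<alpha>\<bar> \<le> M"
    using assms(7) by blast
  have expo: "0 \<le> (q / p) ^ j / p" "(q / p) ^ j / p \<le> 1 / p" for j
    using pq by (auto intro!: divide_right_mono power_le_one)
  \<comment> \<open>The constant depends on the cutoff \<open>c\<close> alone, not on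
    \<open>x\<close> or \<open>j\<close>; the continuity estimate at 1 relies on this
    uniformity.\<close>
  have bound: "\<bar>f (x powr ((q / p) ^ j / p))\<bar> \<le> M / (c powr (1 / p)) powr \<alpha>"
    if "0 < c" "c \<le> 1" "c \<le> x" "x powr ((q / p) ^ j / p) \<le> A" for c x j
    using that expo assms(4)
    by (intro weighted_bound_imp_bound[OF M] powr_mono_base_antimono_exponent) auto

  have summ: "summable (pq_term p q f x)" if x: "x \<in> {0<..A}" for x
  proof -
    \<comment> \<open>Once the exponent is below 1, the sample point is at most max 1 x, hence at
      most \<open>A\<close>.\<close>
    have "(\<lambda>j. (q / p) ^ j / p) \<longlonglongrightarrow> 0"
      using pq by (intro tendsto_divide_zero LIMSEQ_power_zero) auto
    then have "eventually (\<lambda>j. (q / p) ^ j / p < 1) sequentially"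
      by (rule order_tendstoD) simp
    then obtain N where N: "\<And>j. j \<ge> N \<Longrightarrow> (q / p) ^ j / p < 1"
      by (auto simp: eventually_sequentially)
    have "x powr ((q / p) ^ j / p) \<le> A" if "j \<ge> N" for j
      using powr_le_max_one[of x "(q / p) ^ j / p" 1] x expo(1) N[OF that] A by auto
    then have "\<bar>f (x powr ((q / p) ^ j / p))\<bar> \<le> M / (min 1 x powr (1 / p)) powr \<alpha>"
      if "j \<ge> N" for j
      using x that by (intro bound) auto
    then show ?thesis
      using x pq by (intro summable_pq_term) auto
  qed

  have quot: "pq_quotient p q (pq_integral p q f) x = f x" if x: "x \<in> {0<..A}" "x \<noteq> 1" for x
  proof -
    \<comment> \<open>The series is split at \<open>x powr p\<close>, so that point must lie where
      summability is known.\<close>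
    have "x powr p \<le> A"
      using powr_le_max_one[of x p 1] x pq A by auto
    then show ?thesis
      using x pq by (intro pq_quotient_pq_integral summ) auto
  qed

  have cont: "continuous (at 1 within {0<..A}) (pq_integral p q f)"
  proof -
    \<comment> \<open>The cutoff 1/2 stands for any number in (0, 1): all \<open>x\<close> near 1
      exceed it.\<close>
    define B where "B = M / ((1 / 2) powr (1 / p)) powr \<alpha>"
    \<comment> \<open>The largest sample exponent 1/p exceeds 1. If A > 1, continuity of the power
      leaves room near 1; if A = 1, only x \<le> 1 is approached and the power stays at most
      1.\<close>
    have "\<forall>\<^sub>F x in at 1 within {0<..A}. x powr (1 / p) \<le> A"
    proof (cases "A = 1")
      case True
      then show ?thesis
        using pq by (auto simp: eventually_at_filter intro!: always_eventually powr_le1)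
    next
      case False
      have "((\<lambda>x. x powr (1 / p)) \<longlongrightarrow> 1 powr (1 / p)) (at 1 within {0<..A})"
        by (intro tendsto_intros) auto
      then have "\<forall>\<^sub>F x in at 1 within {0<..A}. x powr (1 / p) < A"
        by (rule order_tendstoD) (use A False in auto)
      then show ?thesis
        by (rule eventually_mono) simp
    qed
    moreover have "\<forall>\<^sub>F x in at 1 within {0<..A}. (1 / 2 :: real) < x"
      by (rule order_tendstoD[OF tendsto_ident_at]) simp
    ultimately have ev: "\<forall>\<^sub>F x in at 1 within {0<..A}. norm (pq_integral p q f x) \<le> B * \<bar>x - 1\<bar>"
    proof eventually_elim
      case (elim x)
      have "x powr ((q / p) ^ j / p) \<le> A" for j
        using powr_le_max_one[OF _ expo, of x j] elim A by auto
      then show ?case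
        unfolding real_norm_def B_def
        using elim pq by (intro abs_pq_integral_le bound) auto
    qed
    have "((\<lambda>x. B * \<bar>x - 1\<bar>) \<longlongrightarrow> B * \<bar>1 - 1\<bar>) (at 1 within {0<..A})"
      by (intro tendsto_intros)
    then have "((\<lambda>x. B * \<bar>x - 1\<bar>) \<longlongrightarrow> 0) (at 1 within {0<..A})"
      by simp
    from Lim_null_comparison[OF ev this] show ?thesis
      by (simp add: continuous_within pq_integral_one)
  qed

  \<comment> \<open>At 1 the derivative is the limit of quotients that equal \<open>f\<close>
    elsewhere on (0, A], so continuity of \<open>f\<close> at 1 is what makes this limit
    \<open>f 1\<close>.\<close>
  have anti: "pq_antiderivative_on p q {0<..A} (pq_integral p q f) f"
    if "continuous (at 1 within {0<..A}) f"
  proof -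
    have "\<forall>\<^sub>F x in at 1 within {0<..A}. f x = pq_quotient p q (pq_integral p q f) x"
      using quot by (auto simp: eventually_at_filter)
    with that have "(pq_quotient p q (pq_integral p q f) \<longlongrightarrow> f 1) (at 1 within {0<..A})"
      unfolding continuous_within by (rule Lim_transform_eventually)
    then show ?thesis
      using quot by (auto simp: pq_antiderivative_on_def has_pq_derivative_def)
  qed

  have "pq_antiderivative_on p q ({0<..A} - {1}) (pq_integral p q f) f"
    using quot by (auto simp: pq_antiderivative_on_def has_pq_derivative_def)
  with summ cont anti show ?thesis
    by (auto simp: pq_integral_one)
qed

end
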